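(* Given a weighted graph $G$ on $n$ vertices with integer edge weights bounded by $W$, a parameter $r\in\{1,2,\ldots,\log n\}$, and $\epsilon>0$, it is possible to find a $(1-\epsilon)$-approximation of the maximum cut value $\max_{S\subseteq V}\mathrm{cut}_G(S)$ using $\tilde{O}(\epsilon^{-2} r n^{1+(1+\log W/\log n)/r})$ cut queries in $2r+1$ rounds. The algorithm is randomized and succeeds with probability $1-n^{-2}$.
   Context: Cut-query model: the input is a graph $G=(V,E,w)$ with $n=|V|$ and edge weights $w(e)>0$, accessed only via queries returning $\mathrm{cut}_G(S)=\sum_{e\in E:\,|e\cap S|=1} w(e)$ for a given $S\subseteq V$. An algorithm has round complexity $r$ if its queries are issued in $r$ rounds, queries of round $t$ depending only on answers from earlier rounds. $\tilde{O}(\cdot)$ hides polylogarithmic factors. *)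

theory Defs
  imports "HOL-Probability.Probability"
begin

text \<open>
  Edges are two-element subsets of \<open>V\<close>: graphs are finite, undirected and simple.
\<close>

definition weighted_graph :: "'v set \<Rightarrow> 'v set set \<Rightarrow> ('v set \<Rightarrow> real) \<Rightarrow> bool" where
  "weighted_graph V E w \<longleftrightarrow>
     finite V \<and> (\<forall>e\<in>E. e \<subseteq> V \<and> card e = 2) \<and> (\<forall>e\<in>E. w e > 0)"

definition integer_weights_bounded :: "'v set set \<Rightarrow> ('v set \<Rightarrow> real) \<Rightarrow> nat \<Rightarrow> bool" where
  "integer_weights_bounded E w W \<longleftrightarrow> (\<forall>e\<in>E. w e \<in> \<int> \<and> w e \<le> real W)"

definition cut_value :: "'v set set \<Rightarrow> ('v set \<Rightarrow> real) \<Rightarrow> 'v set \<Rightarrow> real" where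
  "cut_value E w S = (\<Sum>e | e \<in> E \<and> card (e \<inter> S) = 1. w e)"

definition max_cut :: "'v set \<Rightarrow> 'v set set \<Rightarrow> ('v set \<Rightarrow> real) \<Rightarrow> real" where
  "max_cut V E w = Max (cut_value E w ` Pow V)"

text \<open>
  A deterministic query algorithm either halts with a result, or issues one round, i.e. a batch of
  queries \<open>Q\<close> asked simultaneously, and continues depending on the list of answers to \<open>Q\<close>. The batch
  of a round can thus depend only on answers from earlier rounds. The input is accessible only
  through the oracle \<open>f\<close> against which the algorithm is run. A randomized algorithm is a probability
  distribution (\<open>pmf\<close>) over deterministic ones, its random choices being drawn up front. Only
  queries and rounds are counted, not the computation in between.
\<close>

datatype ('v, 'o) query_alg =
    Halt 'o
  | Round "'v set list" "real list \<Rightarrow> ('v, 'o) query_alg"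

primrec result :: "('v, 'o) query_alg \<Rightarrow> ('v set \<Rightarrow> real) \<Rightarrow> 'o" where
  "result (Halt x) f = x"
| "result (Round Q k) f = result (k (map f Q)) f"

primrec rounds :: "('v, 'o) query_alg \<Rightarrow> ('v set \<Rightarrow> real) \<Rightarrow> nat" where
  "rounds (Halt x) f = 0"
| "rounds (Round Q k) f = Suc (rounds (k (map f Q)) f)"

primrec queries :: "('v, 'o) query_alg \<Rightarrow> ('v set \<Rightarrow> real) \<Rightarrow> 'v set list" where
  "queries (Halt x) f = []"
| "queries (Round Q k) f = Q @ queries (k (map f Q)) f"

definition approx_max :: "real \<Rightarrow> real \<Rightarrow> real \<Rightarrow> bool" where
  "approx_max \<epsilon> opt v \<longleftrightarrow> (1 - \<epsilon>) * opt \<le> v \<and> v \<le> opt"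

end

theory Submission
  imports Defs
begin

text \<open>
  It suffices to estimate every cut up to an additive \<open>\<epsilon>/4\<close> fraction of the total edge weight,
  since the maximum cut carries at least half of it. By Hoeffding's inequality and a union bound over
  all \<open>2 ^ n\<close> cuts, \<open>O(n / \<epsilon>\<^sup>2)\<close> edges sampled in proportion to their weight are enough.
  The ordered pairs \<open>(u, v)\<close> are laid out on a line as consecutive intervals whose lengths are
  the edge weights, and a sample is a uniform position on that line. One round of degree queries determines
  \<open>u\<close>, and an \<open>n powr (1 / r)\<close>-ary search on prefix sums, run in parallel for all
  samples, finds \<open>v\<close> in \<open>r\<close> further rounds.
  The length of the line is unknown when the random choices are drawn, so the seeds are uniform below
  a factorial that all possible lengths divide, and are reduced modulo the actual length.
\<close>

section \<open>Searching by cut queries\<close>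

text \<open>Turns the answers to one batch into an oracle, so that the same functions run on answers
  and on the cut function. Outside \<open>Q\<close> its value is unspecified.\<close>

definition answer :: "'v set list \<Rightarrow> real list \<Rightarrow> 'v set \<Rightarrow> real" where
  "answer Q ans S = the (map_of (zip Q ans) S)"

text \<open>Taking the largest index skips empty intervals: if \<open>y < F m\<close>, then
  \<open>F\<close> exceeds \<open>y\<close> at the next index.\<close>

definition locate :: "(nat \<Rightarrow> real) \<Rightarrow> nat \<Rightarrow> real \<Rightarrow> nat" where
  "locate F m y = Max {c. c < m \<and> F c \<le> y}"

text \<open>If \<open>f\<close> is the cut function, this is the total weight between \<open>u\<close> and \<open>T\<close>.\<close>

definition weight_to :: "('v set \<Rightarrow> real) \<Rightarrow> 'v \<Rightarrow> 'v set \<Rightarrow> real" where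
  "weight_to f u T = (f {u} + f (T - {u}) - f (insert u T)) / 2"

text \<open>
  A search state \<open>(u, y, a)\<close> looks for the neighbour of \<open>u\<close> at position \<open>y\<close> when the neighbours, in
  the order of \<open>vs\<close>, occupy consecutive intervals as long as their edge weights; \<open>a\<close> is the lower
  end of the current range of indices, whose length is \<open>d * L\<close> before a refinement with step \<open>L\<close>.
\<close>

definition batch :: "'v list \<Rightarrow> nat \<Rightarrow> nat \<Rightarrow> 'v \<times> real \<times> nat \<Rightarrow> 'v set list" where
  "batch vs d L = (\<lambda>(u, y, a). concat (map (\<lambda>c. let T = set (take (a + c * L) vs) in
     [{u}, T - {u}, insert u T]) [0..<d]))"

definition refine :: "'v list \<Rightarrow> nat \<Rightarrow> nat \<Rightarrow> ('v set \<Rightarrow> real) \<Rightarrow> 'v \<times> real \<times> nat \<Rightarrow> 'v \<times> real \<times> nat" where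
  "refine vs d L f = (\<lambda>(u, y, a).
     (u, y, a + locate (\<lambda>c. weight_to f u (set (take (a + c * L) vs))) d y * L))"

text \<open>Reference version of the search for a single sample. With \<open>t\<close> refinements
  left the range has length \<open>d ^ t\<close>; it may run past the end of \<open>vs\<close>,
  where prefix sums stay constant.\<close>

primrec descend :: "'v list \<Rightarrow> nat \<Rightarrow> ('v set \<Rightarrow> real) \<Rightarrow> nat \<Rightarrow> 'v \<times> real \<times> nat \<Rightarrow> 'v \<times> real \<times> nat" where
  "descend vs d f 0 q = q"
| "descend vs d f (Suc t) q = descend vs d f t (refine vs d (d ^ t) f q)"

primrec search :: "'v list \<Rightarrow> nat \<Rightarrow> (('v \<times> real \<times> nat) list \<Rightarrow> 'o) \<Rightarrow> nat \<Rightarrow>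
    ('v \<times> real \<times> nat) list \<Rightarrow> ('v, 'o) query_alg" where
  "search vs d out 0 st = Halt (out st)"
| "search vs d out (Suc t) st = (let Q = concat (map (batch vs d (d ^ t)) st) in
     Round Q (\<lambda>ans. search vs d out t (map (refine vs d (d ^ t) (answer Q ans)) st)))"

text \<open>The degrees sum to the length of the line, an integer for integer weights, so the floor
  only changes the type. The second component is the offset left inside the row of
  \<open>vs ! i\<close>.\<close>

definition start :: "'v list \<Rightarrow> ('v set \<Rightarrow> real) \<Rightarrow> nat \<Rightarrow> 'v \<times> real \<times> nat" where
  "start vs f z = (let
     D = (\<lambda>i. \<Sum>v\<leftarrow>take i vs. f {v});
     x = real (z mod nat \<lfloor>\<Sum>v\<leftarrow>vs. f {v}\<rfloor>);
     i = locate D (length vs) x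
   in (vs ! i, x - D i, 0))"

section \<open>Output, rounds and queries of the parallel search\<close>

lemma answer_map: "S \<in> set Q \<Longrightarrow> answer Q (map f Q) S = f S"
  by (simp add: answer_def map_of_zip_map)

lemma locate_less: "F 0 \<le> y \<Longrightarrow> 0 < m \<Longrightarrow> locate F m y < m"
  and locate_le: "F 0 \<le> y \<Longrightarrow> 0 < m \<Longrightarrow> F (locate F m y) \<le> y"
proof -
  assume "F 0 \<le> y" "0 < m"
  then have "locate F m y \<in> {c. c < m \<and> F c \<le> y}"
    unfolding locate_def by (intro Max_in) auto
  then show "locate F m y < m" "F (locate F m y) \<le> y" by auto
qed

lemma locate_greater:
  assumes "F 0 \<le> y" "y < F m"
  shows "y < F (Suc (locate F m y))"
proof (rule ccontr)
  assume *: "\<not> y < F (Suc (locate F m y))"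
  have "0 < m" using assms by (cases m) auto
  from locate_less[of F, OF assms(1) this] have "Suc (locate F m y) \<le> m" by simp
  \<comment> \<open>At the last index \<open>m - 1\<close> the assumption \<open>y < F m\<close>
    takes over from maximality.\<close>
  moreover have "Suc (locate F m y) \<noteq> m" using * assms(2) by auto
  ultimately have "Suc (locate F m y) \<in> {c. c < m \<and> F c \<le> y}" using * by auto
  then have "Suc (locate F m y) \<le> locate F m y"
    unfolding locate_def by (intro Max_ge) (auto simp: locate_def)
  then show False by simp
qed

lemma set_batch:
  "set (batch vs d L (u, y, a)) = (\<Union>c<d. {{u}, set (take (a + c * L) vs) - {u}, insert u (set (take (a + c * L) vs))})"
  by (simp add: batch_def Let_def atLeast0LessThan)

text \<open>A refinement consults its oracle only on the sets of its own batch, so the answers to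
  the batch can replace the oracle.\<close>

lemma refine_cong:
  assumes "\<And>S. S \<in> set (batch vs d L q) \<Longrightarrow> g S = f S"
  shows "refine vs d L g q = refine vs d L f q"
proof -
  obtain u y a where q: "q = (u, y, a)" by (cases q) auto
  have "{c. c < d \<and> weight_to g u (set (take (a + c * L) vs)) \<le> y} =
        {c. c < d \<and> weight_to f u (set (take (a + c * L) vs)) \<le> y}"
  proof (intro Collect_cong conj_cong refl)
    fix c assume "c < d"
    then have "g S = f S" if "S \<in> {{u}, set (take (a + c * L) vs) - {u}, insert u (set (take (a + c * L) vs))}" for S
      using assms[of S] that unfolding q set_batch by blast
    then show "(weight_to g u (set (take (a + c * L) vs)) \<le> y) = (weight_to f u (set (take (a + c * L) vs)) \<le> y)"
      by (simp add: weight_to_def)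
  qed
  then show ?thesis by (simp add: q refine_def locate_def)
qed

lemma length_batch: "length (batch vs d L q) = 3 * d"
proof -
  have "(\<Sum>c\<leftarrow>[0..<k]. Suc (Suc (Suc 0))) = 3 * k" for k by (induction k) auto
  then show ?thesis
    by (cases q) (simp add: batch_def length_concat Let_def o_def)
qed

lemma map_refine_answer:
  fixes vs :: "'v list" and d L :: nat and f :: "'v set \<Rightarrow> real"
  defines "Q \<equiv> \<lambda>st. concat (map (batch vs d L) st)"
  shows "map (refine vs d L (answer (Q st) (map f (Q st)))) st = map (refine vs d L f) st"
  by (intro map_cong refl refine_cong answer_map) (auto simp: Q_def)

text \<open>Reduces correctness of the parallel search to single descents against the true cut
  function.\<close>

lemma result_search: "result (search vs d out t st) f = out (map (descend vs d f t) st)"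
proof (induction t arbitrary: st)
  case 0
  show ?case by (simp add: map_idI)
next
  case (Suc t)
  then show ?case by (simp add: Let_def map_refine_answer o_def)
qed

lemma rounds_search: "rounds (search vs d out t st) f = t"
  by (induction t arbitrary: st) (simp_all add: Let_def)

lemma length_queries_search: "length (queries (search vs d out t st) f) = t * (length st * (3 * d))"
proof (induction t arbitrary: st)
  case (Suc t)
  have "(\<Sum>q\<leftarrow>st. length (batch vs d L q)) = length st * (3 * d)" for L
    by (induction st) (simp_all add: length_batch)
  then show ?case by (simp add: Let_def Suc length_concat o_def)
qed simp

lemma queries_search_subset:
  "fst ` set st \<subseteq> set vs \<Longrightarrow> set (queries (search vs d out t st) f) \<subseteq> Pow (set vs)"
proof (induction t arbitrary: st)
  case (Suc t)
  have "fst ` set (map (refine vs d (d ^ t) g) st) \<subseteq> set vs" for g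
    using Suc.prems by (force simp: refine_def)
  moreover have "set (batch vs d L q) \<subseteq> Pow (set vs)" if "q \<in> set st" for q L
  proof -
    have "fst q \<in> set vs" using Suc.prems that by auto
    then show ?thesis
      by (cases q) (auto simp: set_batch dest: in_set_takeD)
  qed
  ultimately show ?case using Suc.IH by (simp add: Let_def Union_least UN_least)
qed simp

lemma start_vertex: "vs \<noteq> [] \<Longrightarrow> fst (start vs f z) \<in> set vs"
  by (simp add: start_def Let_def locate_less)

lemma start_cong: "(\<And>v. v \<in> set vs \<Longrightarrow> g {v} = f {v}) \<Longrightarrow> start vs g z = start vs f z"
proof -
  assume *: "\<And>v. v \<in> set vs \<Longrightarrow> g {v} = f {v}"
  have "(\<Sum>v\<leftarrow>take i vs. g {v}) = (\<Sum>v\<leftarrow>take i vs. f {v})" for i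
    using * by (intro arg_cong[of _ _ sum_list] map_cong refl) (auto dest: in_set_takeD)
  from this this[of "length vs"] show ?thesis by (simp add: start_def)
qed

section \<open>Sampling arcs in proportion to their weight\<close>

definition sample_arc :: "'v list \<Rightarrow> nat \<Rightarrow> ('v set \<Rightarrow> real) \<Rightarrow> nat \<Rightarrow> nat \<Rightarrow> 'v \<times> 'v" where
  "sample_arc vs d f r z = (case descend vs d f r (start vs f z) of (u, y, a) \<Rightarrow> (u, vs ! a))"

text \<open>Both orientations are included, so each cut edge contributes two arcs.\<close>

definition crossing :: "'v set \<Rightarrow> ('v \<times> 'v) set" where
  "crossing S = {(u, v). (u \<in> S) \<noteq> (v \<in> S)}"

text \<open>The graph as a symmetric matrix of natural numbers with zero diagonal, so that positions
  on the line can be counted exactly.\<close>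

locale cut_oracle =
  fixes vs :: "'v list" and wt :: "'v \<Rightarrow> 'v \<Rightarrow> nat" and f :: "'v set \<Rightarrow> real"
  assumes distinct: "distinct vs"
    and wt_sym: "wt u v = wt v u"
    and wt_refl: "wt u u = 0"
    and cut_eq: "S \<subseteq> set vs \<Longrightarrow> f S = (\<Sum>u\<in>S. \<Sum>v\<in>set vs - S. real (wt u v))"
begin

text \<open>Twice the total edge weight, since each edge appears in both orders.\<close>

definition total :: nat where "total = (\<Sum>u\<in>set vs. \<Sum>v\<in>set vs. wt u v)"

definition row :: "'v \<Rightarrow> nat \<Rightarrow> nat" where "row u j = (\<Sum>v\<in>set (take j vs). wt u v)"

lemma degree_eq: "u \<in> set vs \<Longrightarrow> f {u} = real (\<Sum>v\<in>set vs. wt u v)"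
  using wt_refl by (auto simp: cut_eq sum_diff1 of_nat_sum)

text \<open>Split \<open>set vs\<close> into \<open>{u}\<close>, \<open>T' = T - {u}\<close> and the
  rest \<open>R\<close>. In the combination of the three cuts the weights between \<open>u\<close>
  and \<open>R\<close> and between \<open>T'\<close> and \<open>R\<close> cancel, and the weight
  between \<open>u\<close> and \<open>T'\<close> remains twice.\<close>

lemma weight_to_eq:
  assumes "u \<in> set vs" "T \<subseteq> set vs"
  shows "weight_to f u T = (\<Sum>v\<in>T. real (wt u v))"
proof -
  define c where "c = (\<lambda>A B. \<Sum>a\<in>A. \<Sum>b\<in>B. real (wt a b))"
  define T' where "T' = T - {u}"
  define R where "R = set vs - T - {u}"
  have fin: "finite T'" "finite R"
    using assms finite_subset[of T "set vs"] by (auto simp: T'_def R_def)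
  have disj: "T' \<inter> R = {}" "u \<notin> T'" "u \<notin> R" by (auto simp: T'_def R_def)
  have "f {u} = c {u} (T' \<union> R)" "f T' = c T' ({u} \<union> R)" "f (insert u T) = c ({u} \<union> T') R"
    using assms unfolding c_def
    by (subst cut_eq; auto simp: T'_def R_def intro!: sum.cong)+
  moreover have "c {u} (T' \<union> R) = c {u} T' + c {u} R" "c ({u} \<union> T') R = c {u} R + c T' R"
    "c T' ({u} \<union> R) = c T' {u} + c T' R"
    unfolding c_def using fin disj by (simp_all add: sum.union_disjoint sum.distrib)
  moreover have "c T' {u} = c {u} T'"
    by (simp add: c_def wt_sym[of u])
  moreover have "c {u} T' = (\<Sum>v\<in>T. real (wt u v))"
    unfolding c_def T'_def using assms finite_subset[of T "set vs"]
    by (auto simp: wt_refl sum_diff1)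
  ultimately show ?thesis
    by (simp add: weight_to_def T'_def)
qed

lemma weight_to_prefix: "u \<in> set vs \<Longrightarrow> weight_to f u (set (take j vs)) = real (row u j)"
  by (simp add: weight_to_eq row_def set_take_subset)

text \<open>The invariant is that \<open>y\<close> lies between the prefix sums at the two ends of
  the range. Each refinement passes to the block of length \<open>d ^ t\<close> containing
  \<open>y\<close>, and at \<open>t = 0\<close> a single index is left.\<close>

lemma descend_correct:
  assumes "u \<in> set vs" "real (row u a) \<le> y" "y < real (row u (a + d ^ t))"
  shows "\<exists>b. descend vs d f t (u, y, a) = (u, y, b) \<and> real (row u b) \<le> y \<and> y < real (row u (Suc b))"
  using assms(2,3)
proof (induction t arbitrary: a)
  case (Suc t)
  define F where "F = (\<lambda>c. real (row u (a + c * d ^ t)))"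
  have F: "F 0 \<le> y" "y < F d" using Suc.prems by (simp_all add: F_def)
  then have "0 < d" by (cases d) auto
  note loc = locate_le[of F, OF F(1) this] locate_greater[OF F]
  have "descend vs d f (Suc t) (u, y, a) = descend vs d f t (u, y, a + locate F d y * d ^ t)"
    by (simp add: refine_def F_def weight_to_prefix assms(1))
  with loc Suc.IH[of "a + locate F d y * d ^ t"] show ?case
    by (simp add: F_def algebra_simps)
qed auto

lemma sum_degrees_take: "(\<Sum>v\<leftarrow>take i vs. f {v}) = real (\<Sum>u\<in>set (take i vs). \<Sum>v\<in>set vs. wt u v)"
proof -
  have "(\<Sum>v\<leftarrow>take i vs. f {v}) = (\<Sum>v\<in>set (take i vs). f {v})"
    by (simp add: distinct sum_list_distinct_conv_sum_set)
  also have "\<dots> = (\<Sum>u\<in>set (take i vs). real (\<Sum>v\<in>set vs. wt u v))"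
    by (intro sum.cong refl degree_eq) (auto dest: in_set_takeD)
  finally show ?thesis by simp
qed

lemma sum_degrees: "(\<Sum>v\<leftarrow>vs. f {v}) = real total"
  using sum_degrees_take[of "length vs"] by (simp add: total_def)

lemma sum_take_Suc:
  "i < length vs \<Longrightarrow> (\<Sum>u\<in>set (take (Suc i) vs). g u) = (\<Sum>u\<in>set (take i vs). g u) + g (vs ! i)"
proof -
  assume i: "i < length vs"
  have "distinct (take (Suc i) vs)" using distinct by simp
  then have "vs ! i \<notin> set (take i vs)" using i by (simp add: take_Suc_conv_app_nth)
  with i show ?thesis by (simp add: take_Suc_conv_app_nth add.commute)
qed

lemma row_length: "length vs \<le> j \<Longrightarrow> row u j = (\<Sum>v\<in>set vs. wt u v)"
  by (simp add: row_def)

text \<open>Two-level location: the degree prefix sums \<open>D\<close> select the row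
  \<open>i\<close>, and the descent on the offset \<open>x - D i\<close> selects the column within
  it.\<close>

lemma arc_interval:
  assumes "x < total" "length vs \<le> d ^ r"
  shows "\<exists>i j. i < length vs \<and> j < length vs \<and> sample_arc vs d f r x = (vs ! i, vs ! j) \<and>
    x \<in> {(\<Sum>u\<in>set (take i vs). \<Sum>v\<in>set vs. wt u v) + row (vs ! i) j ..<
         (\<Sum>u\<in>set (take i vs). \<Sum>v\<in>set vs. wt u v) + row (vs ! i) j + wt (vs ! i) (vs ! j)}"
proof -
  define D where "D = (\<lambda>i. \<Sum>u\<in>set (take i vs). \<Sum>v\<in>set vs. wt u v)"
  define i where "i = locate (\<lambda>i. real (D i)) (length vs) (real x)"
  have "vs \<noteq> []" using assms(1) by (auto simp: total_def)
  have D: "real (D 0) \<le> real x" "real x < real (D (length vs))"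
    using assms(1) by (simp_all only: D_def total_def of_nat_less_iff of_nat_le_iff) auto
  have i: "i < length vs" "D i \<le> x"
    using locate_less[of "\<lambda>i. real (D i)", OF D(1)] locate_le[of "\<lambda>i. real (D i)", OF D(1)] \<open>vs \<noteq> []\<close>
    by (auto simp: i_def)
  have "x < D (Suc i)"
    using locate_greater[of "\<lambda>i. real (D i)", OF D] by (simp add: i_def)
  \<comment> \<open>As \<open>length vs \<le> d ^ r\<close>, the initial search range covers the
    whole row.\<close>
  also have "D (Suc i) = D i + row (vs ! i) (d ^ r)"
    using i by (simp add: D_def sum_take_Suc row_length assms(2))
  finally have x: "real x - real (D i) < real (row (vs ! i) (0 + d ^ r))" by simp
  have "start vs f x = (vs ! i, real x - real (D i), 0)"
    using assms(1) by (simp add: start_def sum_degrees sum_degrees_take i_def D_def Let_def)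
  moreover obtain b where b: "descend vs d f r (vs ! i, real x - real (D i), 0) = (vs ! i, real x - real (D i), b)"
      "real (row (vs ! i) b) \<le> real x - real (D i)" "real x - real (D i) < real (row (vs ! i) (Suc b))"
    using descend_correct[OF _ _ x] i by (auto simp: row_def)
  \<comment> \<open>Past the end of \<open>vs\<close> two consecutive prefix sums agree, leaving no
    room for the offset.\<close>
  moreover have "b < length vs"
    using b(2,3) row_length[of b "vs ! i"] row_length[of "Suc b" "vs ! i"] by (cases "b < length vs") auto
  moreover from this have "row (vs ! i) (Suc b) = row (vs ! i) b + wt (vs ! i) (vs ! b)"
    by (simp add: row_def sum_take_Suc)
  moreover from this have "D i + row (vs ! i) b \<le> x" "x < D i + row (vs ! i) b + wt (vs ! i) (vs ! b)"
    using b(2,3) by linarith+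
  ultimately show ?thesis
    using i unfolding D_def
    by (intro exI[where x = i and P = "\<lambda>i. \<exists>j. _ i j"], intro exI[where x = b])
       (simp add: sample_arc_def)
qed

text \<open>As \<open>vs\<close> is distinct, an arc determines its two indices, so all positions
  sampling \<open>(u, v)\<close> lie in one interval of length \<open>wt u v\<close>.\<close>

lemma card_arc_le:
  assumes r: "length vs \<le> d ^ r"
  shows "card {x. x < total \<and> sample_arc vs d f r x \<in> A} \<le> (\<Sum>(u, v) \<in> (set vs \<times> set vs) \<inter> A. wt u v)"
proof -
  let ?X = "\<lambda>e. {x. x < total \<and> sample_arc vs d f r x = e}"
  have "{x. x < total \<and> sample_arc vs d f r x \<in> A} \<subseteq> (\<Union>e\<in>(set vs \<times> set vs) \<inter> A. ?X e)"
    using arc_interval[OF _ r] by fastforce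
  then have "card {x. x < total \<and> sample_arc vs d f r x \<in> A} \<le> card (\<Union>e\<in>(set vs \<times> set vs) \<inter> A. ?X e)"
    by (intro card_mono) auto
  also have "\<dots> \<le> (\<Sum>e\<in>(set vs \<times> set vs) \<inter> A. card (?X e))"
    by (intro card_UN_le) auto
  also have "\<dots> \<le> (\<Sum>(u, v)\<in>(set vs \<times> set vs) \<inter> A. wt u v)"
  proof (intro sum_mono, clarsimp)
    fix u v assume "u \<in> set vs" "v \<in> set vs"
    then obtain i j where ij: "i < length vs" "vs ! i = u" "j < length vs" "vs ! j = v"
      by (auto simp: in_set_conv_nth)
    define k where "k = (\<Sum>u\<in>set (take i vs). \<Sum>v\<in>set vs. wt u v) + row u j"
    have "?X (u, v) \<subseteq> {k..<k + wt u v}"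
    proof
      fix x assume "x \<in> ?X (u, v)"
      with arc_interval[OF _ r, of x] obtain i' j' where *: "i' < length vs" "j' < length vs"
          "u = vs ! i'" "v = vs ! j'"
          "x \<in> {(\<Sum>u\<in>set (take i' vs). \<Sum>v\<in>set vs. wt u v) + row (vs ! i') j' ..<
         (\<Sum>u\<in>set (take i' vs). \<Sum>v\<in>set vs. wt u v) + row (vs ! i') j' + wt (vs ! i') (vs ! j')}"
        by auto
      then have "i' = i" "j' = j" using ij distinct nth_eq_iff_index_eq by metis+
      with * ij show "x \<in> {k..<k + wt u v}" by (simp add: k_def)
    qed
    then show "card (?X (u, v)) \<le> wt u v"
      by (metis card_atLeastLessThan card_mono diff_add_inverse finite_atLeastLessThan)
  qed
  finally show ?thesis .
qed

text \<open>The bounds for \<open>A\<close> and its complement add up to \<open>total\<close>, so both are attained.\<close>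

lemma card_arc:
  assumes r: "length vs \<le> d ^ r"
  shows "card {x. x < total \<and> sample_arc vs d f r x \<in> A} = (\<Sum>(u, v) \<in> (set vs \<times> set vs) \<inter> A. wt u v)"
proof -
  have "{..<total} = {x. x < total \<and> sample_arc vs d f r x \<in> A} \<union> {x. x < total \<and> sample_arc vs d f r x \<in> - A}"
    by auto
  then have "total = card ({x. x < total \<and> sample_arc vs d f r x \<in> A} \<union> {x. x < total \<and> sample_arc vs d f r x \<in> - A})"
    by (metis card_lessThan)
  also have "\<dots> = card {x. x < total \<and> sample_arc vs d f r x \<in> A} + card {x. x < total \<and> sample_arc vs d f r x \<in> - A}"
    by (intro card_Un_disjoint) auto
  finally have "total = \<dots>" .
  moreover have "total = (\<Sum>(u, v) \<in> (set vs \<times> set vs) \<inter> A. wt u v) + (\<Sum>(u, v) \<in> (set vs \<times> set vs) \<inter> - A. wt u v)"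
  proof -
    have "total = (\<Sum>(u, v) \<in> set vs \<times> set vs. wt u v)"
      by (simp add: total_def sum.cartesian_product)
    also have "set vs \<times> set vs = ((set vs \<times> set vs) \<inter> A) \<union> ((set vs \<times> set vs) \<inter> - A)" by auto
    finally show ?thesis by (subst (asm) sum.union_disjoint) auto
  qed
  ultimately show ?thesis
    using card_arc_le[OF r, of A] card_arc_le[OF r, of "- A"] by linarith
qed

lemma card_crossing_arc:
  assumes "length vs \<le> d ^ r" "S \<subseteq> set vs"
  shows "real (card {x. x < total \<and> sample_arc vs d f r x \<in> crossing S}) = 2 * f S"
proof -
  let ?w = "\<lambda>(u, v). wt u v" and ?R = "set vs - S"
  have fin: "finite S" using assms finite_subset by auto
  have "set vs \<times> set vs \<inter> crossing S = (S \<times> ?R) \<union> (?R \<times> S)"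
    using assms by (auto simp: crossing_def)
  moreover have "sum ?w ((S \<times> ?R) \<union> (?R \<times> S)) = sum ?w (S \<times> ?R) + sum ?w (?R \<times> S)"
    using fin by (intro sum.union_disjoint) auto
  moreover have "sum ?w (?R \<times> S) = sum ?w (S \<times> ?R)"
    by (rule sum.reindex_bij_witness[of _ prod.swap prod.swap]) (auto simp: wt_sym)
  moreover have "real (sum ?w (S \<times> ?R)) = f S"
    using assms by (simp add: cut_eq flip: sum.cartesian_product)
  ultimately show ?thesis using card_arc[OF assms(1), of "crossing S"] by simp
qed

lemma cut_le_total: "S \<subseteq> set vs \<Longrightarrow> 2 * f S \<le> real total"
proof -
  assume S: "S \<subseteq> set vs"
  obtain d :: nat where d: "length vs \<le> d ^ 1" by auto
  have "card {x. x < total \<and> sample_arc vs d f 1 x \<in> crossing S} \<le> card {..<total}"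
    by (intro card_mono) auto
  with card_crossing_arc[OF d S] show ?thesis by simp
qed

text \<open>Averaging over all \<open>S\<close>: each ordered pair of distinct vertices is separated, in this order,
  by a quarter of the sets.\<close>

lemma exists_large_cut: "\<exists>S\<subseteq>set vs. real total / 4 \<le> f S"
proof (rule ccontr)
  assume neg: "\<not> (\<exists>S\<subseteq>set vs. real total / 4 \<le> f S)"
  let ?P = "Pow (set vs)" and ?n = "card (set vs)"
  have sep: "4 * real (card {S \<in> ?P. u \<in> S \<and> v \<notin> S}) * real (wt u v) = 2 ^ ?n * real (wt u v)"
    if uv: "u \<in> set vs" "v \<in> set vs" for u v
  proof (cases "u = v")
    case False
    \<comment> \<open>Only membership of the other \<open>?n - 2\<close> vertices is free, which
      gives the quarter.\<close>
    have "{S \<in> ?P. u \<in> S \<and> v \<notin> S} = insert u ` Pow (set vs - {u, v})"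
    proof (intro equalityI subsetI)
      fix S assume "S \<in> {S \<in> ?P. u \<in> S \<and> v \<notin> S}"
      then show "S \<in> insert u ` Pow (set vs - {u, v})"
        by (intro image_eqI[of _ _ "S - {u}"]) auto
    qed (use uv False in auto)
    moreover have "inj_on (insert u) (Pow (set vs - {u, v}))"
      by (rule inj_onI) (metis Diff_insert_absorb DiffD2 PowD insertI1 subsetD)
    ultimately have "card {S \<in> ?P. u \<in> S \<and> v \<notin> S} = 2 ^ (?n - 2)"
      using uv False by (simp add: card_image card_Pow card_Diff_subset)
    moreover have "?n \<ge> 2"
      using uv False card_mono[of "set vs" "{u, v}"] by simp
    then have "(2::real) ^ ?n = 4 * 2 ^ (?n - 2)"
      using power_add[of "2::real" 2 "?n - 2"] by (simp only: le_add_diff_inverse) simp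
    ultimately show ?thesis by simp
  qed (simp add: wt_refl)
  have "4 * (\<Sum>S\<in>?P. f S) = 4 * (\<Sum>S\<in>?P. \<Sum>u\<in>set vs. \<Sum>v\<in>set vs. if u \<in> S \<and> v \<notin> S then real (wt u v) else 0)"
  proof (intro arg_cong[of _ _ "(*) 4"] sum.cong refl)
    fix S assume S: "S \<in> ?P"
    have "(\<Sum>u\<in>set vs. \<Sum>v\<in>set vs. if u \<in> S \<and> v \<notin> S then real (wt u v) else 0) =
          (\<Sum>u\<in>S. \<Sum>v\<in>set vs. if u \<in> S \<and> v \<notin> S then real (wt u v) else 0)"
      using S by (intro sum.mono_neutral_right) (auto)
    also have "\<dots> = (\<Sum>u\<in>S. \<Sum>v\<in>set vs - S. real (wt u v))"
      using S by (intro sum.cong refl sum.mono_neutral_cong_right) auto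
    finally show "f S = (\<Sum>u\<in>set vs. \<Sum>v\<in>set vs. if u \<in> S \<and> v \<notin> S then real (wt u v) else 0)"
      using S by (simp add: cut_eq)
  qed
  also have "\<dots> = 4 * (\<Sum>u\<in>set vs. \<Sum>v\<in>set vs. \<Sum>S\<in>?P. if u \<in> S \<and> v \<notin> S then real (wt u v) else 0)"
    by (subst sum.swap) (simp add: sum.swap[of _ _ "Pow (set vs)"])
  also have "\<dots> = (\<Sum>u\<in>set vs. \<Sum>v\<in>set vs. 4 * real (card {S \<in> ?P. u \<in> S \<and> v \<notin> S}) * real (wt u v))"
    by (simp add: sum_distrib_left sum.If_cases Int_def mult.assoc)
  also have "\<dots> = (\<Sum>u\<in>set vs. \<Sum>v\<in>set vs. 2 ^ ?n * real (wt u v))"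
    by (intro sum.cong refl sep)
  also have "\<dots> = 2 ^ ?n * real total"
    by (simp add: total_def sum_distrib_left)
  finally have "4 * (\<Sum>S\<in>?P. f S) = 2 ^ ?n * real total" .
  moreover have "(\<Sum>S\<in>?P. f S) < (\<Sum>S\<in>?P. real total / 4)"
    using neg by (intro sum_strict_mono) auto
  ultimately show False by (simp add: card_Pow)
qed

end

section \<open>The algorithm\<close>

text \<open>A frequency \<open>p\<close> of crossing arcs corresponds to cut value
  \<open>m / 2 * p\<close>, where \<open>m\<close> is the sum of degrees. Subtracting
  \<open>\<delta>\<close> guards against exceeding the optimum.\<close>

definition estimate :: "'v list \<Rightarrow> real \<Rightarrow> nat \<Rightarrow> real \<Rightarrow> (nat \<Rightarrow> 'v \<times> 'v) \<Rightarrow> real" where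
  "estimate vs m s \<delta> e =
     m / 2 * (Max ((\<lambda>S. real (card {i. i < s \<and> e i \<in> crossing S}) / real s) ` Pow (set vs)) - \<delta>)"

definition max_cut_alg :: "'v list \<Rightarrow> nat \<Rightarrow> nat \<Rightarrow> nat \<Rightarrow> real \<Rightarrow> (nat \<Rightarrow> nat) \<Rightarrow> ('v, real) query_alg" where
  "max_cut_alg vs d r s \<delta> x = (let Q = map (\<lambda>v. {v}) vs in Round Q (\<lambda>ans. let g = answer Q ans in
     search vs d (\<lambda>st. estimate vs (\<Sum>v\<leftarrow>vs. g {v}) s \<delta> (\<lambda>i. case st ! i of (u, y, a) \<Rightarrow> (u, vs ! a))) r
       (map (\<lambda>i. start vs g (x i)) [0..<s])))"

section \<open>Output, rounds and queries of the algorithm\<close>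

lemma result_max_cut_alg:
  "result (max_cut_alg vs d r s \<delta> x) f =
     estimate vs (\<Sum>v\<leftarrow>vs. f {v}) s \<delta> (\<lambda>i. sample_arc vs d f r (x i))"
proof -
  let ?Q = "map (\<lambda>v. {v}) vs"
  let ?g = "answer ?Q (map f ?Q)"
  have g: "?g {v} = f {v}" if "v \<in> set vs" for v
    using that by (intro answer_map) auto
  have "(\<Sum>v\<leftarrow>vs. ?g {v}) = (\<Sum>v\<leftarrow>vs. f {v})"
    using g by (intro arg_cong[of _ _ sum_list] map_cong refl)
  moreover have "start vs ?g z = start vs f z" for z
    by (intro start_cong g)
  ultimately show ?thesis
    by (simp add: max_cut_alg_def Let_def result_search estimate_def sample_arc_def cong: conj_cong)
qed

lemma rounds_max_cut_alg: "rounds (max_cut_alg vs d r s \<delta> x) f = Suc r"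
  by (simp add: max_cut_alg_def Let_def rounds_search)

lemma length_queries_max_cut_alg:
  "length (queries (max_cut_alg vs d r s \<delta> x) f) = length vs + r * (s * (3 * d))"
  by (simp add: max_cut_alg_def Let_def length_queries_search)

lemma queries_max_cut_alg_subset:
  assumes "vs \<noteq> []"
  shows "set (queries (max_cut_alg vs d r s \<delta> x) f) \<subseteq> Pow (set vs)"
proof -
  have "fst ` set (map (\<lambda>i. start vs g (x i)) [0..<s]) \<subseteq> set vs" for g
    by (simp add: image_subset_iff start_vertex assms)
  from queries_search_subset[OF this] show ?thesis
    by (simp add: max_cut_alg_def Let_def image_subset_iff)
qed

section \<open>Concentration\<close>

text \<open>Each residue \<open>i < m\<close> has exactly \<open>k\<close> preimages
  \<open>j * m + i\<close> with \<open>j < k\<close>.\<close>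

lemma map_pmf_mod_uniform:
  assumes "0 < k" "0 < m"
  shows "map_pmf (\<lambda>z. z mod m) (pmf_of_set {..<k * m}) = pmf_of_set {..<m::nat}"
proof (rule pmf_eqI)
  fix i
  have ne: "{..<k * m} \<noteq> {}" "{..<m} \<noteq> {}" using assms by (auto simp: lessThan_empty_iff)
  have "real (card ({..<k * m} \<inter> {z. z mod m = i})) = (if i < m then real k else 0)"
  proof (cases "i < m")
    case True
    have "{..<k * m} \<inter> {z. z mod m = i} = (\<lambda>j. j * m + i) ` {..<k}"
    proof (intro equalityI subsetI)
      fix z assume "z \<in> {..<k * m} \<inter> {z. z mod m = i}"
      then show "z \<in> (\<lambda>j. j * m + i) ` {..<k}"
        by (intro image_eqI[of _ _ "z div m"]) (auto simp: less_mult_imp_div_less)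
    next
      fix z assume "z \<in> (\<lambda>j. j * m + i) ` {..<k}"
      then obtain j where j: "j < k" "z = j * m + i" by auto
      then have "z < Suc j * m" using True by simp
      also have "\<dots> \<le> k * m" using j by (intro mult_right_mono) auto
      finally show "z \<in> {..<k * m} \<inter> {z. z mod m = i}" using True j by simp
    qed
    moreover have "inj_on (\<lambda>j. j * m + i) {..<k}" using assms by (auto simp: inj_on_def)
    ultimately show ?thesis using True by (simp add: card_image)
  next
    case False
    then have "{..<k * m} \<inter> {z. z mod m = i} = {}" using assms by auto
    with False show ?thesis by simp
  qed
  then show "pmf (map_pmf (\<lambda>z. z mod m) (pmf_of_set {..<k * m})) i = pmf (pmf_of_set {..<m}) i"
    using assms ne by (simp add: pmf_map measure_pmf_of_set vimage_def Int_commute indicator_def)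
qed

lemma map_pmf_bool_eq_bernoulli:
  "map_pmf P M = bernoulli_pmf (measure_pmf.prob M {z. P z})"
proof (rule pmf_eqI)
  fix b
  have "measure_pmf.prob M {z. \<not> P z} = 1 - measure_pmf.prob M {z. P z}"
    using measure_pmf.prob_compl[of "{z. P z}" M] by (simp add: Compl_eq_Diff_UNIV[symmetric] Collect_neg_eq)
  then show "pmf (map_pmf P M) b = pmf (bernoulli_pmf (measure_pmf.prob M {z. P z})) b"
    by (cases b) (simp_all add: pmf_map vimage_def)
qed

text \<open>The number of samples satisfying \<open>P\<close> is binomially distributed, so
  Hoeffding's inequality for the binomial distribution applies.\<close>

lemma Hoeffding_frequency:
  assumes "0 < s" "0 \<le> \<delta>"
  shows "measure_pmf.prob (Pi_pmf {..<s} c (\<lambda>_. M))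
           {x. \<bar>real (card {i. i < s \<and> P (x i)}) / real s - measure_pmf.prob M {z. P z}\<bar> \<ge> \<delta>}
         \<le> 2 * exp (- 2 * real s * \<delta>\<^sup>2)"
proof -
  define p where "p = measure_pmf.prob M {z. P z}"
  interpret binomial_distribution s p
    by unfold_locales (simp add: p_def)
  have "binomial_pmf s p = map_pmf (\<lambda>h. card {i \<in> {..<s}. h i}) (Pi_pmf {..<s} (P c) (\<lambda>_. bernoulli_pmf p))"
    using p by (intro binomial_pmf_altdef') auto
  \<comment> \<open>Applying \<open>P\<close> to each coordinate gives independent Bernoulli
    variables; the default value \<open>c\<close> becomes \<open>P c\<close>.\<close>
  also have "Pi_pmf {..<s} (P c) (\<lambda>_. bernoulli_pmf p) = map_pmf (\<lambda>h. P \<circ> h) (Pi_pmf {..<s} c (\<lambda>_. M))"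
    unfolding p_def map_pmf_bool_eq_bernoulli[symmetric] by (intro Pi_pmf_map) auto
  finally have "binomial_pmf s p = map_pmf (\<lambda>x. card {i. i < s \<and> P (x i)}) (Pi_pmf {..<s} c (\<lambda>_. M))"
    by (simp add: map_pmf_comp)
  with prob_abs_ge'[OF assms] show ?thesis
    by (simp add: p_def vimage_def)
qed

section \<open>Accuracy of the estimate with high probability\<close>

context cut_oracle
begin

lemma sample_arc_mod: "sample_arc vs d f r (z mod total) = sample_arc vs d f r z"
  by (simp add: sample_arc_def start_def sum_degrees)

text \<open>Divisibility makes the seed uniform modulo \<open>total\<close>, so the probability is
  the fraction of positions counted by \<open>card_crossing_arc\<close>.\<close>

lemma prob_crossing:
  assumes "length vs \<le> d ^ r" "S \<subseteq> set vs" "0 < N" "total dvd N"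
  shows "measure_pmf.prob (pmf_of_set {..<N}) {z. sample_arc vs d f r z \<in> crossing S} = 2 * f S / real total"
proof -
  obtain k where N: "N = k * total" using assms(4) by (metis dvdE mult.commute)
  with assms(3) have pos: "0 < k" "0 < total" by (auto intro: Nat.gr0I)
  have "measure_pmf.prob (pmf_of_set {..<N}) {z. sample_arc vs d f r z \<in> crossing S} =
        measure_pmf.prob (map_pmf (\<lambda>z. z mod total) (pmf_of_set {..<N})) {z. sample_arc vs d f r z \<in> crossing S}"
    by (simp add: sample_arc_mod vimage_def)
  also have "\<dots> = measure_pmf.prob (pmf_of_set {..<total}) {z. sample_arc vs d f r z \<in> crossing S}"
    by (simp add: N map_pmf_mod_uniform[OF pos])
  also have "\<dots> = real (card {x. x < total \<and> sample_arc vs d f r x \<in> crossing S}) / real total"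
    using pos by (subst measure_pmf_of_set) (auto simp: lessThan_empty_iff Int_def)
  finally show ?thesis by (simp add: card_crossing_arc assms(1,2))
qed

text \<open>The shift by \<open>\<delta>\<close> cancels any overestimate of a frequency. Below, at
  most \<open>2 * \<delta>\<close> is lost in frequency, that is \<open>\<delta> * total\<close> in
  cut value.\<close>

lemma estimate_approx:
  assumes close: "\<And>S. S \<subseteq> set vs \<Longrightarrow>
      \<bar>real (card {i. i < s \<and> e i \<in> crossing S}) / real s - 2 * f S / real total\<bar> < \<delta>"
    and pos: "0 < total"
  shows "approx_max (4 * \<delta>) (Max (f ` Pow (set vs))) (estimate vs (real total) s \<delta> e)"
proof -
  let ?F = "\<lambda>S. real (card {i. i < s \<and> e i \<in> crossing S}) / real s"
  define opt where "opt = Max (f ` Pow (set vs))"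
  define est where "est = Max (?F ` Pow (set vs))"
  have "0 < \<delta>" using close[of "{}"] by simp
  have opt_ge: "f S \<le> opt" if "S \<subseteq> set vs" for S
    unfolding opt_def using that by (intro Max_ge) auto
  have "est \<in> ?F ` Pow (set vs)" unfolding est_def by (intro Max_in) auto
  then obtain S where S: "S \<subseteq> set vs" "est = ?F S" by auto
  have "est \<le> 2 * opt / real total + \<delta>"
    using close[OF S(1)] divide_right_mono[of "2 * f S" "2 * opt" "real total"] opt_ge[OF S(1)] S(2)
    by linarith
  then have upper: "real total / 2 * (est - \<delta>) \<le> opt" using pos by (simp add: field_simps)
  have "opt \<in> f ` Pow (set vs)" unfolding opt_def by (intro Max_in) auto
  then obtain T where T: "T \<subseteq> set vs" "opt = f T" by auto
  have "?F T \<le> est" unfolding est_def using T by (intro Max_ge) auto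
  with close[OF T(1), folded T(2)] have "2 * opt / real total - 2 * \<delta> \<le> est - \<delta>" by linarith
  then have "opt - \<delta> * real total \<le> real total / 2 * (est - \<delta>)" using pos by (simp add: field_simps)
  \<comment> \<open>The optimum is at least \<open>total / 4\<close>, which turns the additive loss
    into a relative loss of \<open>4 * \<delta>\<close>.\<close>
  moreover have "real total / 4 \<le> opt" using exists_large_cut opt_ge order_trans by blast
  then have "\<delta> * real total \<le> \<delta> * (4 * opt)" using \<open>0 < \<delta>\<close> by (intro mult_left_mono) auto
  ultimately have "(1 - 4 * \<delta>) * opt \<le> real total / 2 * (est - \<delta>)" by (simp add: algebra_simps)
  with upper show ?thesis
    by (simp add: approx_max_def estimate_def opt_def est_def)
qed

text \<open>Union bound over the \<open>2 ^ length vs\<close> sets, each failing with at most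
  Hoeffding's probability.\<close>

lemma prob_approx_max:
  assumes r: "length vs \<le> d ^ r" and s: "0 < s" and \<delta>: "0 < \<delta>" and N: "0 < N" "0 < total \<Longrightarrow> total dvd N"
  shows "measure_pmf.prob (Pi_pmf {..<s} c (\<lambda>_. pmf_of_set {..<N}))
      {x. approx_max (4 * \<delta>) (Max (f ` Pow (set vs))) (result (max_cut_alg vs d r s \<delta> x) f)}
    \<ge> 1 - 2 ^ length vs * (2 * exp (- 2 * real s * \<delta>\<^sup>2))"
proof (cases "total = 0")
  case True
  \<comment> \<open>Without edge weight all cuts vanish, and so does the factor \<open>m\<close> of
    the estimate, whatever the seeds.\<close>
  have "f S = 0" if "S \<subseteq> set vs" for S
    using cut_le_total[OF that] cut_eq[OF that] True by (simp add: antisym sum_nonneg)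
  then have "f ` Pow (set vs) = {0}" by auto
  then have "{x. approx_max (4 * \<delta>) (Max (f ` Pow (set vs))) (result (max_cut_alg vs d r s \<delta> x) f)} = UNIV"
    by (simp add: result_max_cut_alg sum_degrees True approx_max_def estimate_def)
  then show ?thesis by simp
next
  case False
  then have pos: "0 < total" by simp
  let ?M = "Pi_pmf {..<s} c (\<lambda>_. pmf_of_set {..<N})"
  define bad where "bad = (\<lambda>S. {x. \<bar>real (card {i. i < s \<and> sample_arc vs d f r (x i) \<in> crossing S}) / real s
      - 2 * f S / real total\<bar> \<ge> \<delta>})"
  let ?good = "{x. approx_max (4 * \<delta>) (Max (f ` Pow (set vs))) (result (max_cut_alg vs d r s \<delta> x) f)}"
  have "- (\<Union>S\<in>Pow (set vs). bad S) \<subseteq> ?good"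
  proof
    fix x assume x: "x \<in> - (\<Union>S\<in>Pow (set vs). bad S)"
    have "approx_max (4 * \<delta>) (Max (f ` Pow (set vs)))
        (estimate vs (real total) s \<delta> (\<lambda>i. sample_arc vs d f r (x i)))"
      by (rule estimate_approx[OF _ pos]) (use x in \<open>auto simp: bad_def not_le\<close>)
    then show "x \<in> ?good" by (simp add: result_max_cut_alg sum_degrees)
  qed
  then have "measure_pmf.prob ?M (- (\<Union>S\<in>Pow (set vs). bad S)) \<le> measure_pmf.prob ?M ?good"
    by (intro measure_pmf.finite_measure_mono) auto
  moreover have "measure_pmf.prob ?M (- (\<Union>S\<in>Pow (set vs). bad S)) = 1 - measure_pmf.prob ?M (\<Union>S\<in>Pow (set vs). bad S)"
    using measure_pmf.prob_compl[of "\<Union>S\<in>Pow (set vs). bad S" ?M] by (simp add: Compl_eq_Diff_UNIV)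
  moreover have "measure_pmf.prob ?M (\<Union>S\<in>Pow (set vs). bad S) \<le> (\<Sum>S\<in>Pow (set vs). measure_pmf.prob ?M (bad S))"
    by (intro measure_pmf.finite_measure_subadditive_finite) auto
  moreover have "(\<Sum>S\<in>Pow (set vs). measure_pmf.prob ?M (bad S)) \<le> (\<Sum>S\<in>Pow (set vs). 2 * exp (- 2 * real s * \<delta>\<^sup>2))"
  proof (intro sum_mono)
    fix S assume "S \<in> Pow (set vs)"
    then show "measure_pmf.prob ?M (bad S) \<le> 2 * exp (- 2 * real s * \<delta>\<^sup>2)"
      using Hoeffding_frequency[OF s, of \<delta> c "pmf_of_set {..<N}" "\<lambda>z. sample_arc vs d f r z \<in> crossing S"] \<delta>
      by (simp add: bad_def prob_crossing[OF r _ N(1) N(2)[OF pos]])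
  qed
  ultimately show ?thesis by (simp add: card_Pow distinct_card[OF distinct])
qed

end

section \<open>Weighted graphs\<close>

text \<open>The floor is exact on integer weights. For \<open>u = v\<close> the set
  \<open>{u, v}\<close> is a singleton and hence not an edge.\<close>

definition nat_weight :: "'v set set \<Rightarrow> ('v set \<Rightarrow> real) \<Rightarrow> 'v \<Rightarrow> 'v \<Rightarrow> nat" where
  "nat_weight E w u v = (if {u, v} \<in> E then nat \<lfloor>w {u, v}\<rfloor> else 0)"

text \<open>A cut edge has exactly one orientation leading from \<open>S\<close> to its complement,
  so edges and pairs in \<open>A\<close> correspond bijectively; other pairs weigh zero.\<close>

lemma cut_value_eq_sum:
  assumes G: "weighted_graph V E w" "integer_weights_bounded E w W" and S: "S \<subseteq> V"
  shows "cut_value E w S = (\<Sum>u\<in>S. \<Sum>v\<in>V - S. real (nat_weight E w u v))"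
proof -
  have fin: "finite V" "finite S" using G S finite_subset by (auto simp: weighted_graph_def)
  define A where "A = {(u, v) \<in> S \<times> (V - S). {u, v} \<in> E}"
  have "{e. e \<in> E \<and> card (e \<inter> S) = 1} = (\<lambda>(u, v). {u, v}) ` A"
  proof (intro equalityI subsetI)
    fix e assume "e \<in> {e. e \<in> E \<and> card (e \<inter> S) = 1}"
    then have e: "e \<in> E" "card (e \<inter> S) = 1" "e \<subseteq> V" "card e = 2"
      using G by (auto simp: weighted_graph_def)
    then obtain u where u: "e \<inter> S = {u}" by (auto simp: card_1_singleton_iff)
    obtain a b where ab: "e = {a, b}" "a \<noteq> b" using e(4) by (auto simp: card_2_iff)
    then have "u = a \<and> b \<notin> S \<or> u = b \<and> a \<notin> S"
      using u by (cases "a \<in> S"; cases "b \<in> S") auto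
    then consider "u = a" "b \<notin> S" | "u = b" "a \<notin> S" by blast
    then obtain v where "e = {u, v}" "v \<notin> S" using ab by cases auto
    then show "e \<in> (\<lambda>(u, v). {u, v}) ` A"
      using e u by (intro image_eqI[of _ _ "(u, v)"]) (auto simp: A_def)
  next
    fix e assume "e \<in> (\<lambda>(u, v). {u, v}) ` A"
    then obtain u v where "e = {u, v}" "u \<in> S" "v \<notin> S" "e \<in> E" by (auto simp: A_def)
    moreover from this have "e \<inter> S = {u}" by auto
    ultimately show "e \<in> {e. e \<in> E \<and> card (e \<inter> S) = 1}" by simp
  qed
  moreover have "inj_on (\<lambda>(u, v). {u, v}) A"
    by (auto simp: inj_on_def A_def doubleton_eq_iff)
  ultimately have "cut_value E w S = (\<Sum>(u, v)\<in>A. w {u, v})"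
    by (simp add: cut_value_def sum.reindex case_prod_unfold)
  also have "\<dots> = (\<Sum>(u, v)\<in>A. real (nat_weight E w u v))"
  proof (intro sum.cong refl, clarify)
    fix u v assume "(u, v) \<in> A"
    then have e: "{u, v} \<in> E" by (auto simp: A_def)
    with G have "w {u, v} \<in> \<int>" "0 < w {u, v}"
      by (auto simp: weighted_graph_def integer_weights_bounded_def)
    then show "w {u, v} = real (nat_weight E w u v)"
      using e by (auto simp: nat_weight_def elim!: Ints_cases)
  qed
  also have "\<dots> = (\<Sum>(u, v)\<in>S \<times> (V - S). real (nat_weight E w u v))"
    using fin by (intro sum.mono_neutral_left) (auto simp: A_def nat_weight_def split: if_splits)
  finally show ?thesis by (simp add: sum.cartesian_product)
qed

lemma cut_oracle_cut_value:
  assumes G: "weighted_graph (set vs) E w" "integer_weights_bounded E w W" and "distinct vs"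
  shows "cut_oracle vs (nat_weight E w) (cut_value E w)"
proof
  show "nat_weight E w u u = 0" for u
    using G by (force simp: weighted_graph_def nat_weight_def)
qed (use assms in \<open>auto simp: nat_weight_def insert_commute cut_value_eq_sum\<close>)

text \<open>Hence every nonzero total divides the factorial of this bound, which depends only on the
  number of vertices and \<open>W\<close>.\<close>

lemma total_le:
  assumes "cut_oracle vs (nat_weight E w) f" "integer_weights_bounded E w W"
  shows "cut_oracle.total vs (nat_weight E w) \<le> length vs * length vs * W"
proof -
  interpret cut_oracle vs "nat_weight E w" f by fact
  have "nat_weight E w u v \<le> W" for u v
    using assms(2) by (auto simp: nat_weight_def integer_weights_bounded_def floor_le_iff nat_le_iff intro: le_floor_iff)
  then have "total \<le> (\<Sum>u\<in>set vs. \<Sum>v\<in>set vs. W)"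
    unfolding total_def by (intro sum_mono)
  then show ?thesis by (simp add: distinct_card[OF distinct])
qed

section \<open>Choice of the parameters\<close>

definition arity :: "nat \<Rightarrow> nat \<Rightarrow> nat" where
  "arity n r = nat \<lceil>real n powr (1 / real r)\<rceil>"

text \<open>Chosen so that with \<open>\<delta> = \<epsilon> / 4\<close> the Hoeffding exponent
  \<open>2 * s * \<delta>\<^sup>2\<close> is at least \<open>4 * n\<close>.\<close>

definition samples :: "nat \<Rightarrow> real \<Rightarrow> nat" where
  "samples n \<epsilon> = nat \<lceil>32 * real n / \<epsilon>\<^sup>2\<rceil>"

text \<open>For \<open>\<epsilon> \<ge> 1\<close> the answer 0 is already good enough. Otherwise the
  accuracy is \<open>\<epsilon> / 4\<close> because the relative error is four times as
  large.\<close>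

definition max_cut_pmf :: "nat set \<Rightarrow> nat \<Rightarrow> nat \<Rightarrow> real \<Rightarrow> (nat, real) query_alg pmf" where
  "max_cut_pmf V W r \<epsilon> = (if \<epsilon> \<ge> 1 then return_pmf (Halt 0) else
     map_pmf (max_cut_alg (sorted_list_of_set V) (arity (card V) r) r (samples (card V) \<epsilon>) (\<epsilon> / 4))
       (Pi_pmf {..<samples (card V) \<epsilon>} 0 (\<lambda>_. pmf_of_set {..<fact (card V * card V * W)})))"

lemma le_arity_power:
  assumes "n \<ge> 1" "r \<ge> 1"
  shows "n \<le> arity n r ^ r"
proof -
  have "real n = (real n powr (1 / real r)) ^ r"
    using assms by (simp add: powr_realpow[symmetric] powr_powr)
  also have "\<dots> \<le> real (arity n r) ^ r"
    unfolding arity_def by (intro power_mono) (linarith, simp)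
  finally show ?thesis by (metis of_nat_le_iff of_nat_power)
qed

lemma arity_le:
  assumes "n \<ge> 1"
  shows "real (arity n r) \<le> 2 * real n powr (1 / real r)"
proof -
  have "1 \<le> real n powr (1 / real r)" using assms by (intro ge_one_powr_ge_zero) auto
  then show ?thesis unfolding arity_def by linarith
qed

lemma samples_ge: "32 * real n / \<epsilon>\<^sup>2 \<le> real (samples n \<epsilon>)"
  unfolding samples_def by linarith

lemma samples_le:
  assumes "n \<ge> 1" "0 < \<epsilon>" "\<epsilon> < 1"
  shows "real (samples n \<epsilon>) \<le> 33 * real n / \<epsilon>\<^sup>2"
proof -
  have "\<epsilon>\<^sup>2 \<le> 1" using assms by (simp add: power_le_one)
  \<comment> \<open>Rounding up costs at most 1, which this bound absorbs: 33 instead of 32.\<close>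
  then have "1 \<le> real n / \<epsilon>\<^sup>2" using assms by (simp add: field_simps)
  moreover have "0 \<le> 32 * real n / \<epsilon>\<^sup>2" by simp
  ultimately show ?thesis unfolding samples_def by linarith
qed

text \<open>From \<open>exp 4 \<ge> 16\<close>, \<open>n \<le> 2 ^ n\<close> and
  \<open>2 \<le> 2 ^ n\<close> one gets
  \<open>2 * n\<^sup>2 * 2 ^ n \<le> 16 ^ n \<le> exp (4 * n)\<close>.\<close>

lemma failure_le:
  assumes "n \<ge> 2" "0 < \<epsilon>"
  shows "2 ^ n * (2 * exp (- 2 * real (samples n \<epsilon>) * (\<epsilon> / 4)\<^sup>2)) \<le> real n powr (- 2)"
proof -
  have "4 * real n = 2 * (32 * real n / \<epsilon>\<^sup>2) * (\<epsilon> / 4)\<^sup>2"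
    using assms by (simp add: field_simps power2_eq_square)
  also have "\<dots> \<le> 2 * real (samples n \<epsilon>) * (\<epsilon> / 4)\<^sup>2"
    using samples_ge by (intro mult_right_mono mult_left_mono) auto
  finally have "exp (real n * 4) \<le> exp (2 * real (samples n \<epsilon>) * (\<epsilon> / 4)\<^sup>2)" by simp
  moreover have "(2::real) ^ 4 \<le> exp 1 ^ 4"
    using exp_ge_add_one_self[of 1] by (intro power_mono) auto
  then have "16 \<le> exp (4::real)" by (simp flip: exp_of_nat_mult)
  then have "16 ^ n \<le> exp (4::real) ^ n" by (intro power_mono) auto
  then have "16 ^ n \<le> exp (real n * 4)" by (simp add: exp_of_nat_mult)
  moreover have "2 * (real n)\<^sup>2 * 2 ^ n \<le> 16 ^ n"
  proof -
    have "real n \<le> 2 ^ n" using less_exp[of n] by (metis less_imp_le of_nat_le_iff of_nat_numeral of_nat_power)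
    then have "(real n)\<^sup>2 \<le> (2 ^ n)\<^sup>2" by (intro power_mono) auto
    moreover have "(2::real) \<le> 2 ^ n" using power_increasing[of 1 n "2::real"] assms by simp
    ultimately have "2 * (real n)\<^sup>2 * 2 ^ n \<le> 2 ^ n * (2 ^ n)\<^sup>2 * 2 ^ n" by (intro mult_mono) auto
    also have "\<dots> = (2 ^ n) ^ 4" by (simp add: power2_eq_square power4_eq_xxxx)
    also have "\<dots> = (2 ^ 4) ^ n" by (simp only: mult.commute flip: power_mult)
    also have "\<dots> = 16 ^ n" by simp
    finally show ?thesis .
  qed
  ultimately have "2 * (real n)\<^sup>2 * 2 ^ n \<le> exp (2 * real (samples n \<epsilon>) * (\<epsilon> / 4)\<^sup>2)" by linarith
  then show ?thesis
    using assms by (simp add: exp_minus powr_minus powr_numeral field_simps)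
qed

text \<open>The constant is \<open>199 = 1 + 3 * 33 * 2\<close>: the degree queries, then three
  queries per prefix weight, with 33 from \<open>samples_le\<close> and 2 from
  \<open>arity_le\<close>.\<close>

lemma query_count_le:
  assumes "n \<ge> 2" "W \<ge> 1" "r \<ge> 1" "0 < \<epsilon>" "\<epsilon> < 1"
  shows "real (n + r * (samples n \<epsilon> * (3 * arity n r)))
    \<le> 199 * (\<epsilon> powr (- 2) * real r * real n powr (1 + (1 + log 2 (real W) / log 2 (real n)) / real r))"
proof -
  define X where "X = real n * real n powr (1 / real r)"
  define Y where "Y = X / \<epsilon>\<^sup>2"
  have "real (samples n \<epsilon>) * real (arity n r) \<le> (33 * real n / \<epsilon>\<^sup>2) * (2 * real n powr (1 / real r))"
    using assms by (intro mult_mono samples_le arity_le) auto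
  then have "real r * (3 * (real (samples n \<epsilon>) * real (arity n r))) \<le> real r * (3 * (66 * Y))"
    by (intro mult_left_mono) (auto simp: X_def Y_def)
  moreover have "real n \<le> real r * Y"
  proof -
    have "1 \<le> real n powr (1 / real r)" using assms by (intro ge_one_powr_ge_zero) auto
    then have "real n \<le> X" unfolding X_def using assms by simp
    also have "X \<le> Y" using assms by (simp add: X_def Y_def field_simps power_le_one mult_left_le)
    also have "\<dots> \<le> real r * Y"
      using assms mult_right_mono[of 1 "real r" Y] by (simp add: X_def Y_def)
    finally show ?thesis .
  qed
  ultimately have "real (n + r * (samples n \<epsilon> * (3 * arity n r))) \<le> 199 * (real r * Y)"
    by (simp add: algebra_simps)
  also have "\<dots> = 199 * (\<epsilon> powr (- 2) * real r * X)"
    using assms by (simp add: Y_def powr_minus powr_numeral field_simps)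
  also have "X = real n powr (1 + 1 / real r)"
    using assms by (simp add: X_def powr_add)
  \<comment> \<open>\<open>W \<ge> 1\<close> makes the logarithm of \<open>W\<close> nonnegative, so
    the exponent only grows.\<close>
  also have "\<dots> \<le> real n powr (1 + (1 + log 2 (real W) / log 2 (real n)) / real r)"
    using assms by (intro powr_mono add_left_mono divide_right_mono) auto
  finally show ?thesis using assms by (simp add: mult_left_mono)
qed

(* The soft-O is spelled out with absolute constants C and k: a factor C * (log n)^k, valid for all
   parameters. Vertices are natural numbers so that C and k do not depend on a type variable. *)
theorem mainTheorem4:
  shows "\<exists>(alg :: nat set \<Rightarrow> nat \<Rightarrow> nat \<Rightarrow> real \<Rightarrow> (nat, real) query_alg pmf) (C :: real) (k :: nat).
    \<forall>(V :: nat set) (n :: nat) (W :: nat) (r :: nat) (\<epsilon> :: real).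
      finite V \<and> card V = n \<and> n \<ge> 2 \<and> W \<ge> 1 \<and> 1 \<le> r \<and> real r \<le> log 2 (real n) \<and> \<epsilon> > 0 \<longrightarrow>
      (\<forall>E w. weighted_graph V E w \<and> integer_weights_bounded E w W \<longrightarrow>
        (\<forall>a \<in> set_pmf (alg V W r \<epsilon>).
           set (queries a (cut_value E w)) \<subseteq> Pow V \<and>
           rounds a (cut_value E w) \<le> 2 * r + 1 \<and>
           real (length (queries a (cut_value E w)))
             \<le> C * log 2 (real n) ^ k *
               (\<epsilon> powr (- 2) * real r *
                real n powr (1 + (1 + log 2 (real W) / log 2 (real n)) / real r))) \<and>
        measure_pmf.prob (alg V W r \<epsilon>)
          {a. approx_max \<epsilon> (max_cut V E w) (result a (cut_value E w))} \<ge> 1 - real n powr (- 2))"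
\<comment> \<open>The bound of \<open>query_count_le\<close> has no logarithmic factor, so
  \<open>k = 0\<close>. The \<open>r + 1\<close> rounds used are at most
  \<open>2 * r + 1\<close>.\<close>
proof (rule exI[of _ max_cut_pmf], rule exI[of _ 199], rule exI[of _ 0], intro allI impI conjI ballI)
  fix V :: "nat set" and n W r :: nat and \<epsilon> :: real and E :: "nat set set" and w :: "nat set \<Rightarrow> real"
  assume "finite V \<and> card V = n \<and> n \<ge> 2 \<and> W \<ge> 1 \<and> 1 \<le> r \<and> real r \<le> log 2 (real n) \<and> \<epsilon> > 0"
    and "weighted_graph V E w \<and> integer_weights_bounded E w W"
  then have V: "finite V" "card V = n" and par: "n \<ge> 2" "W \<ge> 1" "1 \<le> r" "0 < \<epsilon>"
    and G: "weighted_graph V E w" "integer_weights_bounded E w W" by auto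
  define vs where "vs = sorted_list_of_set V"
  have vs: "set vs = V" "distinct vs" "length vs = n" "vs \<noteq> []"
    using V par by (auto simp: vs_def)
  interpret cut_oracle vs "nat_weight E w" "cut_value E w"
    using G vs by (intro cut_oracle_cut_value) auto
  {
    fix a assume a: "a \<in> set_pmf (max_cut_pmf V W r \<epsilon>)"
    then consider "\<epsilon> \<ge> 1" "a = Halt 0"
      | x where "\<epsilon> < 1" "a = max_cut_alg vs (arity n r) r (samples n \<epsilon>) (\<epsilon> / 4) x"
      by (auto simp: max_cut_pmf_def vs_def V split: if_splits)
    then have "set (queries a (cut_value E w)) \<subseteq> Pow V \<and> rounds a (cut_value E w) \<le> 2 * r + 1 \<and>
      real (length (queries a (cut_value E w))) \<le> 199 * (\<epsilon> powr (- 2) * real r *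
        real n powr (1 + (1 + log 2 (real W) / log 2 (real n)) / real r))"
    proof cases
      case 2
      then show ?thesis
        using queries_max_cut_alg_subset[OF vs(4)] query_count_le[OF par(1,2,3,4)]
        by (simp add: rounds_max_cut_alg length_queries_max_cut_alg vs)
    qed simp
  }
  note bounds = this
  show "set (queries a (cut_value E w)) \<subseteq> Pow V"
    and "rounds a (cut_value E w) \<le> 2 * r + 1"
    and "real (length (queries a (cut_value E w))) \<le> 199 * log 2 (real n) ^ 0 * (\<epsilon> powr (- 2) * real r *
      real n powr (1 + (1 + log 2 (real W) / log 2 (real n)) / real r))"
    if "a \<in> set_pmf (max_cut_pmf V W r \<epsilon>)" for a
    using bounds[OF that] by simp_all
  show "measure_pmf.prob (max_cut_pmf V W r \<epsilon>)
      {a. approx_max \<epsilon> (max_cut V E w) (result a (cut_value E w))} \<ge> 1 - real n powr (- 2)"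
  proof (cases "\<epsilon> \<ge> 1")
    case True
    \<comment> \<open>The empty set has cut value 0, so 0 lies between
      \<open>(1 - \<epsilon>) * opt\<close> and the optimum \<open>opt\<close>.\<close>
    have "0 \<le> max_cut V E w"
      unfolding max_cut_def using V by (intro Max_ge) (auto simp: cut_value_def intro!: image_eqI[of _ _ "{}"])
    with True show ?thesis
      by (simp add: max_cut_pmf_def approx_max_def mult_nonpos_nonneg)
  next
    case False
    have "0 < 32 * real n / \<epsilon>\<^sup>2" using par by simp
    then have s: "0 < samples n \<epsilon>" using samples_ge[of n \<epsilon>] by linarith
    have N: "total dvd fact (n * n * W)" if "0 < total"
      using that total_le[OF cut_oracle_axioms G(2)] vs by (intro dvd_fact) auto
    let ?P = "Pi_pmf {..<samples n \<epsilon>} 0 (\<lambda>_. pmf_of_set {..<fact (n * n * W)})"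
    have "1 - real n powr (- 2) \<le>
        1 - 2 ^ length vs * (2 * exp (- 2 * real (samples n \<epsilon>) * (\<epsilon> / 4)\<^sup>2))"
      using failure_le[OF par(1,4)] vs by simp
    also have "\<dots> \<le> measure_pmf.prob ?P {x. approx_max (4 * (\<epsilon> / 4)) (Max (cut_value E w ` Pow (set vs)))
        (result (max_cut_alg vs (arity n r) r (samples n \<epsilon>) (\<epsilon> / 4) x) (cut_value E w))}"
      using par vs le_arity_power[of n r] s N by (intro prob_approx_max) auto
    also have "\<dots> = measure_pmf.prob (max_cut_pmf V W r \<epsilon>)
        {a. approx_max \<epsilon> (max_cut V E w) (result a (cut_value E w))}"
      using False by (simp add: max_cut_pmf_def V vs vimage_def max_cut_def flip: vs_def)
    finally show ?thesis .
  qed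
qed

end
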